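(* For any $n, N \in \mathbb{N}$ and $a_1,\dots,a_n \in \mathbb{C}$, the following identity holds: $$\sum_{1 \leq x_1 < \dots < x_n \leq N} \det\bigl(a_i^{x_j}\bigr)_{i,j=1}^{n} = \prod_{k=1}^n \frac{a_k}{a_k-1} \sum_{J \subset \{1,\dots,n\}} (-1)^{\nu(J^c)}\, \gamma(J)\, \gamma(J^c) \prod_{j\in J} a_j^N ,$$ where the sum on the left is over integers $x_1,\dots,x_n$, the sum on the right is over all subsets $J$ of $\{1,\dots,n\}$ (including $\emptyset$ and the full set), and $J^c = \{1,\dots,n\}\setminus J$.
   Context: $\mathbb{N}$ denotes the positive integers. For $I \subset \{1,\dots,n\}$, $\nu(I) = \sum_{k \in I} k$. For $J = \{j_1,\dots,j_k\} \subset \{1,\dots,n\}$ with $j_1 < \dots < j_k$, $\Delta(J)$ is the Vandermonde determinant $\Delta(J) = \det\bigl(a_{j_r}^{s-1}\bigr)_{r,s=1}^{k}$ (row $r$ is $1, a_{j_r}, \dots, a_{j_r}^{k-1}$), and $$\gamma(J) = \frac{1}{\prod_{\{i,j\} \subset J} (a_i a_j - 1)}\,\Delta(J),$$ where the product is over all two-element subsets $\{i,j\}$ of $J$; moreover $\gamma(\emptyset) = \gamma(\{k\}) = 1$.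
   Formalization: The identity is stated for those a_1,…,a_n for which the right-hand side is defined: a_k ≠ 1 for all k and a_i a_j ≠ 1 for all i ≠ j; for other values a denominator vanishes. *)

theory Defs
  imports Complex_Main "HOL-Library.FuncSet" "Jordan_Normal_Form.Determinant"
begin

definition nu :: "nat set \<Rightarrow> nat" where
  "nu I = \<Sum>I"

(* Matrices are indexed from 0: entry (r, s) is the 1-based entry (r + 1, s + 1),
   and sorted_list_of_set J ! r is the (r + 1)-st smallest element of J. *)
definition vandermonde_det :: "(nat \<Rightarrow> complex) \<Rightarrow> nat set \<Rightarrow> complex" where
  "vandermonde_det a J =
     det (mat (card J) (card J) (\<lambda>(r, s). a (sorted_list_of_set J ! r) ^ s))"

(* Each two-element subset {i, j} of J is represented by the pair with i < j. *)
definition gam :: "(nat \<Rightarrow> complex) \<Rightarrow> nat set \<Rightarrow> complex" where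
  "gam a J =
     1 / (\<Prod>(i, j) \<in> {(i, j). i \<in> J \<and> j \<in> J \<and> i < j}. (a i * a j - 1)) * vandermonde_det a J"

(* Integer tuples 1 \<le> x 1 < ... < x n \<le> N; extensionality outside {1..n}
   makes each tuple occur exactly once. *)
definition increasing_tuples :: "nat \<Rightarrow> nat \<Rightarrow> (nat \<Rightarrow> nat) set" where
  "increasing_tuples n N = {x \<in> {1..n} \<rightarrow>\<^sub>E {1..N}. strict_mono_on {1..n} x}"

end

theory Submission
  imports Defs
begin

text \<open>
  Both sides are determined by the same recursion in \<open>N\<close>, with a finite set \<open>I\<close> of indices in place
  of \<open>{1..n}\<close>. On the left, a tuple bounded by \<open>N + 1\<close> either is bounded by \<open>N\<close> or ends in \<open>N + 1\<close>;
  in the second case, expanding the determinant along its last column gives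
  \[ S_I(N + 1) = S_I(N) + \sum_{i \in I} \pm\, a_i^{N+1} S_{I \setminus i}(N),
     \qquad S_I(0) = 0 \mbox{ for } I \neq \emptyset, \]
  where the sign is the parity of the number of elements of \<open>I\<close> above \<open>i\<close>.

  The right-hand side is a combination of the exponentials $N \mapsto \prod_{j \in J} a_j^N$.
  Comparing the coefficients of one exponential, it satisfies the same recursion as soon as
  \[ \gamma(J) \Bigl(\prod_{j \in J} a_j - 1\Bigr) = \sum_{i \in J} \pm (a_i - 1)\, \gamma(J \setminus i)
     \qquad \mbox{(lemma \<open>gam_recurrence\<close>).} \]
  After division by \<open>\<gamma>(J)\<close> this is a partial fraction identity: the leading coefficient of
  $\prod_{j \in J} (z a_j - 1)$ is computed by interpolation at the points $a_j$ and $-1$.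

  The initial value asks for $T_I = \sum_J c_J = 0$ for nonempty \<open>I\<close>, where $c_J$ is the coefficient
  of the exponential of \<open>J\<close> without the common prefactor (lemma \<open>sum_subset_coeff_eq_0\<close>). This is not a termwise cancellation.
  By induction on the size of \<open>I\<close>, the identity above gives $\sum_J c_J a_J = T_I$, where
  $a_J = \prod_{j \in J} a_j$. Its analogue for the inverses of the \<open>a\<^sub>i\<close>
  (\<open>gam_recurrence_dual\<close>, interpolation at $a_j$, $-1$ and $0$) gives
  $\sum_J c_J a_{I \setminus J} = a_I T_I$. Exchanging \<open>J\<close> with its complement multiplies all $c_J$ by
  one common sign, so the two sums agree up to that sign, and \<open>T\<^sub>I\<close> agrees with itself up to the same
  sign. Hence $a_I T_I = T_I$, and $T_I = 0$ unless $a_I = 1$.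

  The divisions require that the \<open>a\<^sub>i\<close> are distinct and avoid a few special positions
  (\<open>generic\<close>). Both sides are continuous at every \<open>a\<close> that is admitted by the theorem, and
  $a_i + t (i + 1)$ is generic for all small \<open>t \<noteq> 0\<close>, so the general case follows by letting
  \<open>t\<close> tend to 0.
\<close>

section \<open>Interpolation\<close>

text \<open>
  The left-hand side is the coefficient of degree \<open>card X - 1\<close> in the Lagrange form of the polynomial of degree
  below \<open>card X\<close> that takes the values of \<open>p\<close> on \<open>X\<close>, and this polynomial is \<open>p\<close>.
\<close>

lemma sum_interpolation:
  fixes p :: "'a::field poly"
  assumes fin: "finite X" and deg: "degree p < card X"
  shows "(\<Sum>x\<in>X. poly p x / (\<Prod>y\<in>X - {x}. x - y)) = coeff p (card X - 1)"
proof -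
  define b where "b x = (\<Prod>y\<in>X - {x}. [:- y, 1:])" for x
  define q where "q = (\<Sum>x\<in>X. smult (poly p x / (\<Prod>y\<in>X - {x}. x - y)) (b x))"
  have deg_b: "degree (b x) = card X - 1" and lead_b: "coeff (b x) (card X - 1) = 1" if "x \<in> X" for x
  proof -
    show *: "degree (b x) = card X - 1"
      unfolding b_def using that fin by (subst degree_prod_eq_sum_degree) auto
    have "lead_coeff (b x) = 1"
      unfolding b_def lead_coeff_prod by simp
    then show "coeff (b x) (card X - 1) = 1" using * by simp
  qed
  have "p = q"
  proof (rule poly_eqI_degree)
    fix z assume z: "z \<in> X"
    have "poly (b x) z = 0" if "x \<in> X" "x \<noteq> z" for x
      unfolding b_def poly_prod using fin z that by (intro prod_zero) auto
    then have "poly q z = (\<Sum>x\<in>X. if x = z then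
        poly p z / (\<Prod>y\<in>X - {z}. z - y) * poly (b z) z else 0)"
      unfolding q_def poly_sum by (intro sum.cong) auto
    also have "\<dots> = poly p z / (\<Prod>y\<in>X - {z}. z - y) * poly (b z) z"
      using fin z by simp
    also have "\<dots> = poly p z"
      using fin by (simp add: b_def poly_prod)
    finally show "poly p z = poly q z" by simp
  next
    have "degree q \<le> card X - 1"
      unfolding q_def using fin deg_b
      by (intro degree_sum_le) (auto intro: order_trans[OF degree_smult_le])
    then show "degree q < card X" using deg by linarith
  qed (use deg in auto)
  then have "coeff p (card X - 1) = coeff q (card X - 1)" by simp
  also have "\<dots> = (\<Sum>x\<in>X. poly p x / (\<Prod>y\<in>X - {x}. x - y))"
    unfolding q_def coeff_sum using lead_b by (intro sum.cong) auto
  finally show ?thesis by simp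
qed

text \<open>
  Most nodes are values of the family \<open>a\<close>, and sums over the index set are wanted for them; \<open>Z\<close>
  holds the remaining nodes. Specialising \<open>Z\<close> yields the Vandermonde determinant (no extra node)
  and both partial fraction identities (\<open>-1\<close>; \<open>0\<close> and \<open>-1\<close>).
\<close>

lemma sum_interpolation_extra_nodes:
  fixes a :: "nat \<Rightarrow> 'a::field"
  assumes fin: "finite J" "finite Z" and inj: "inj_on a J" and disj: "Z \<inter> a ` J = {}"
    and deg: "degree p < card Z + card J"
  shows "(\<Sum>i\<in>J. poly p (a i) / ((\<Prod>z\<in>Z. a i - z) * (\<Prod>k\<in>J - {i}. a i - a k))) +
      (\<Sum>z\<in>Z. poly p z / ((\<Prod>y\<in>Z - {z}. z - y) * (\<Prod>j\<in>J. z - a j))) =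
    coeff p (card Z + card J - 1)"
proof -
  let ?X = "a ` J \<union> Z"
  let ?f = "\<lambda>x. poly p x / (\<Prod>y\<in>?X - {x}. x - y)"
  have card: "card ?X = card Z + card J"
    using fin disj inj by (subst card_Un_disjoint) (auto simp: card_image)
  have "sum ?f ?X = sum ?f (a ` J) + sum ?f Z"
    using fin disj by (intro sum.union_disjoint) auto
  also have "sum ?f (a ` J) =
      (\<Sum>i\<in>J. poly p (a i) / ((\<Prod>z\<in>Z. a i - z) * (\<Prod>k\<in>J - {i}. a i - a k)))"
  proof (subst sum.reindex[OF inj], rule sum.cong[OF refl])
    fix i assume i: "i \<in> J"
    have "a i \<notin> Z" using i disj by blast
    then have eq: "?X - {a i} = Z \<union> a ` (J - {i})"
      using inj_on_image_set_diff[OF inj, of J "{i}"] i by auto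
    have "(\<Prod>y\<in>?X - {a i}. a i - y) = (\<Prod>z\<in>Z. a i - z) * (\<Prod>y\<in>a ` (J - {i}). a i - y)"
      unfolding eq using fin disj by (intro prod.union_disjoint) auto
    also have "(\<Prod>y\<in>a ` (J - {i}). a i - y) = (\<Prod>k\<in>J - {i}. a i - a k)"
      using inj_on_diff[OF inj] by (subst prod.reindex) auto
    finally show "(?f \<circ> a) i =
        poly p (a i) / ((\<Prod>z\<in>Z. a i - z) * (\<Prod>k\<in>J - {i}. a i - a k))" by simp
  qed
  also have "sum ?f Z = (\<Sum>z\<in>Z. poly p z / ((\<Prod>y\<in>Z - {z}. z - y) * (\<Prod>j\<in>J. z - a j)))"
  proof (rule sum.cong[OF refl])
    fix z assume z: "z \<in> Z"
    have eq: "?X - {z} = (Z - {z}) \<union> a ` J" using z disj by blast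
    have "(\<Prod>y\<in>?X - {z}. z - y) = (\<Prod>y\<in>Z - {z}. z - y) * (\<Prod>y\<in>a ` J. z - y)"
      unfolding eq using fin disj by (intro prod.union_disjoint) auto
    also have "(\<Prod>y\<in>a ` J. z - y) = (\<Prod>j\<in>J. z - a j)"
      using inj by (subst prod.reindex) auto
    finally show "?f z = poly p z / ((\<Prod>y\<in>Z - {z}. z - y) * (\<Prod>j\<in>J. z - a j))" by simp
  qed
  finally show ?thesis
    using sum_interpolation[of ?X p] fin deg card by simp
qed

section \<open>Determinants with rows indexed by a finite set\<close>

definition above :: "nat set \<Rightarrow> nat \<Rightarrow> nat" where
  "above I i = card {k \<in> I. i < k}"

text \<open>
  Indexing the rows by a set of natural numbers, in increasing order, makes the minors of a
  determinant again determinants of this form, without renumbering of the rows.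
\<close>

definition det_rows :: "(nat \<Rightarrow> nat \<Rightarrow> 'a::comm_ring_1) \<Rightarrow> nat set \<Rightarrow> 'a" where
  "det_rows f I = det (mat (card I) (card I) (\<lambda>(r, s). f (sorted_list_of_set I ! r) s))"

lemma det_rows_empty [simp]: "det_rows f {} = 1"
  by (simp add: det_rows_def)

lemma above_nth_sorted_list:
  assumes "finite I" "r < card I"
  shows "above I (sorted_list_of_set I ! r) = card I - 1 - r"
proof -
  let ?l = "sorted_list_of_set I"
  have len: "length ?l = card I" by simp
  have less: "?l ! s < ?l ! t" if "s < t" "t < card I" for s t
    using that len strict_sorted_list_of_set[of I] by (simp add: sorted_wrt_nth_less)
  have "{k \<in> I. ?l ! r < k} = (\<lambda>s. ?l ! s) ` {r<..<card I}"
  proof (intro equalityI subsetI)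
    fix k assume k: "k \<in> {k \<in> I. ?l ! r < k}"
    then obtain s where s: "s < card I" "k = ?l ! s"
      using assms(1) len by (metis (no_types, lifting) in_set_conv_nth mem_Collect_eq set_sorted_list_of_set)
    with k have "r < s" using less assms by (metis (no_types, lifting) linorder_neqE_nat mem_Collect_eq order_less_asym)
    with s show "k \<in> (\<lambda>s. ?l ! s) ` {r<..<card I}" by auto
  next
    fix k assume "k \<in> (\<lambda>s. ?l ! s) ` {r<..<card I}"
    then show "k \<in> {k \<in> I. ?l ! r < k}"
      using less assms len by (auto, metis nth_mem set_sorted_list_of_set)
  qed
  moreover have "inj_on (\<lambda>s. ?l ! s) {r<..<card I}"
    by (intro inj_on_nth) auto
  ultimately show ?thesis
    unfolding above_def by (simp add: card_image)
qed

lemma nth_sorted_list_of_set_Diff: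
  assumes "finite I" "r < card I" "s < card I - 1"
  shows "sorted_list_of_set (I - {sorted_list_of_set I ! r}) ! s =
    sorted_list_of_set I ! (if s < r then s else Suc s)"
proof -
  let ?l = "sorted_list_of_set I"
  have "sorted_list_of_set (I - {?l ! r}) = remove1 (?l ! r) ?l"
    using assms(1) by (rule sorted_list_of_set_remove)
  also have "\<dots> = take r ?l @ drop (Suc r) ?l"
  proof -
    have r: "r < length ?l" using assms by simp
    have "?l = take r ?l @ ?l ! r # drop (Suc r) ?l"
      using r by (simp add: id_take_nth_drop)
    moreover have "?l ! r \<notin> set (take r ?l)"
      using r distinct_sorted_list_of_set[of I]
      by (metis calculation distinct_append disjoint_insert(1) list.simps(15))
    ultimately show ?thesis
      by (metis remove1.simps(2) remove1_append)
  qed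
  finally show ?thesis
    using assms by (auto simp: nth_append min_def)
qed

text \<open>
  With 0-based position \<open>r\<close> of \<open>i\<close>, the cofactor sign is \<open>(-1) ^ (r + m)\<close> for \<open>m = card I - 1\<close>; since
  \<open>m - r\<close> elements of \<open>I\<close> lie above \<open>i\<close>, it depends on \<open>above I i\<close> only.
\<close>

lemma det_rows_expand_last_column:
  assumes fin: "finite I" and ne: "I \<noteq> {}"
  shows "det_rows f I =
    (\<Sum>i\<in>I. (-1) ^ above I i * f i (card I - 1) * det_rows f (I - {i}))"
proof -
  let ?l = "sorted_list_of_set I"
  define m where "m = card I - 1"
  have card: "card I = Suc m" using fin ne by (simp add: m_def card_gt_0_iff)
  define A where "A = mat (card I) (card I) (\<lambda>(r, s). f (?l ! r) s)"
  have A: "A \<in> carrier_mat (card I) (card I)" by (simp add: A_def)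
  have "det_rows f I = (\<Sum>r<card I. A $$ (r, m) * cofactor A r m)"
    unfolding det_rows_def A_def[symmetric] by (rule laplace_expansion_column[OF A]) (simp add: card)
  also have "\<dots> = (\<Sum>r<card I. (-1) ^ above I (?l ! r) * f (?l ! r) m * det_rows f (I - {?l ! r}))"
  proof (rule sum.cong[OF refl])
    fix r assume "r \<in> {..<card I}"
    then have r: "r < card I" by simp
    then have "?l ! r \<in> I" using fin by (metis length_sorted_list_of_set nth_mem set_sorted_list_of_set)
    then have card': "card (I - {?l ! r}) = m" using fin card by simp
    have "mat_delete A r m = mat m m (\<lambda>(r', s). f (sorted_list_of_set (I - {?l ! r}) ! r') s)"
      unfolding mat_delete_def using r fin card
      by (intro eq_matI) (auto simp: A_def nth_sorted_list_of_set_Diff)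
    then have "det (mat_delete A r m) = det_rows f (I - {?l ! r})"
      by (simp add: det_rows_def card')
    moreover have "(-1 :: 'a) ^ (r + m) = (-1) ^ above I (?l ! r)"
    proof -
      have "r + m = 2 * r + above I (?l ! r)"
        using r card above_nth_sorted_list[OF fin r] by simp
      then show ?thesis by (simp add: power_add)
    qed
    ultimately show "A $$ (r, m) * cofactor A r m =
        (-1) ^ above I (?l ! r) * f (?l ! r) m * det_rows f (I - {?l ! r})"
      using r card by (simp add: cofactor_def A_def)
  qed
  also have "\<dots> = (\<Sum>i\<in>I. (-1) ^ above I i * f i m * det_rows f (I - {i}))"
    by (rule sum.reindex_bij_betw)
       (rule bij_betw_nth, use fin in auto)
  finally show ?thesis by (simp add: m_def)
qed

text \<open>
  Both the Vandermonde determinant and the denominator of \<open>gam\<close> have this form. What matters is how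
  it changes when one index is removed, for symmetric and for antisymmetric \<open>F\<close>.
\<close>

definition pair_prod :: "(nat \<Rightarrow> nat \<Rightarrow> 'a::comm_monoid_mult) \<Rightarrow> nat set \<Rightarrow> 'a" where
  "pair_prod F J = (\<Prod>(i, j) \<in> {(i, j). i \<in> J \<and> j \<in> J \<and> i < j}. F i j)"

lemma pair_prod_remove:
  assumes fin: "finite J" and i: "i \<in> J"
  shows "pair_prod F J =
    pair_prod F (J - {i}) * (\<Prod>k | k \<in> J \<and> k < i. F k i) * (\<Prod>k | k \<in> J \<and> i < k. F i k)"
proof -
  let ?P = "\<lambda>J. {(i, j). i \<in> J \<and> j \<in> J \<and> i < (j::nat)}"
  let ?L = "(\<lambda>k. (k, i)) ` {k. k \<in> J \<and> k < i}" and ?U = "(\<lambda>k. (i, k)) ` {k. k \<in> J \<and> i < k}"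
  have fin': "finite (?P (J - {i}))" "finite ?L" "finite ?U"
    using fin by (auto intro: finite_subset[of _ "J \<times> J"])
  have "?P J = ?P (J - {i}) \<union> ?L \<union> ?U" using i by (auto simp: image_iff)
  then have "pair_prod F J = prod (\<lambda>(i, j). F i j) (?P (J - {i}) \<union> ?L \<union> ?U)"
    by (simp add: pair_prod_def)
  also have "\<dots> = prod (\<lambda>(i, j). F i j) (?P (J - {i})) * prod (\<lambda>(i, j). F i j) ?L *
      prod (\<lambda>(i, j). F i j) ?U"
    using fin' by (subst prod.union_disjoint; (subst prod.union_disjoint)?) auto
  finally show ?thesis
    by (simp add: pair_prod_def prod.reindex inj_on_def)
qed

lemma prod_remove_split:
  assumes fin: "finite J"
  shows "(\<Prod>k\<in>J - {i::nat}. G k) = (\<Prod>k | k \<in> J \<and> k < i. G k) * (\<Prod>k | k \<in> J \<and> i < k. G k)"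
proof -
  have "J - {i} = {k. k \<in> J \<and> k < i} \<union> {k. k \<in> J \<and> i < k}" by auto
  moreover have "prod G ({k. k \<in> J \<and> k < i} \<union> {k. k \<in> J \<and> i < k}) =
      (\<Prod>k | k \<in> J \<and> k < i. G k) * (\<Prod>k | k \<in> J \<and> i < k. G k)"
    using fin by (intro prod.union_disjoint) auto
  ultimately show ?thesis by simp
qed

lemma pair_prod_remove_sym:
  assumes "finite J" "i \<in> J" "\<And>j k. F j k = F k j"
  shows "pair_prod F J = pair_prod F (J - {i}) * (\<Prod>k\<in>J - {i}. F i k)"
  using assms by (simp add: pair_prod_remove[of J i] prod_remove_split mult.assoc cong: prod.cong)

lemma pair_prod_remove_antisym:
  fixes F :: "nat \<Rightarrow> nat \<Rightarrow> 'a::comm_ring_1"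
  assumes fin: "finite J" and i: "i \<in> J" and antisym: "\<And>j k. F j k = - F k j"
  shows "pair_prod F J = (-1) ^ above J i * pair_prod F (J - {i}) * (\<Prod>k\<in>J - {i}. F k i)"
proof -
  have "(\<Prod>k | k \<in> J \<and> i < k. F i k) = (\<Prod>k | k \<in> J \<and> i < k. - F k i)"
    by (rule prod.cong[OF refl]) (rule antisym)
  also have "\<dots> = (-1) ^ above J i * (\<Prod>k | k \<in> J \<and> i < k. F k i)"
    by (simp add: prod_uminus above_def)
  finally show ?thesis
    using fin i by (simp add: pair_prod_remove[of J i] prod_remove_split mult_ac)
qed

lemma vandermonde_det_eq_det_rows: "vandermonde_det a J = det_rows (\<lambda>i s. a i ^ s) J"
  by (simp add: vandermonde_det_def det_rows_def)

text \<open>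
  Expansion along the last column and induction express the determinant as the product times
  \<open>\<Sum>i\<in>J. a i ^ m / (\<Prod>k\<in>J - {i}. a i - a k)\<close>, which is the leading coefficient of \<open>z ^ m\<close> computed by
  interpolation, hence \<open>1\<close>.
\<close>

lemma vandermonde_det_eq_pair_prod:
  assumes "finite J" "inj_on a J"
  shows "vandermonde_det a J = pair_prod (\<lambda>i j. a j - a i) J"
  using assms
proof (induction "card J" arbitrary: J)
  case 0
  then show ?case by (simp add: vandermonde_det_eq_det_rows pair_prod_def)
next
  case (Suc m)
  let ?F = "\<lambda>i j. a j - a i"
  have ne: "J \<noteq> {}" using Suc.hyps by auto
  have nz: "(\<Prod>k\<in>J - {i}. a i - a k) \<noteq> 0" if "i \<in> J" for i
    using that Suc.prems by (auto simp: inj_on_def)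
  have "vandermonde_det a J = (\<Sum>i\<in>J. (-1) ^ above J i * a i ^ m * pair_prod ?F (J - {i}))"
    unfolding vandermonde_det_eq_det_rows det_rows_expand_last_column[OF Suc.prems(1) ne]
  proof (rule sum.cong[OF refl])
    fix i assume i: "i \<in> J"
    have "det_rows (\<lambda>i s. a i ^ s) (J - {i}) = pair_prod ?F (J - {i})"
      using Suc.hyps(1)[of "J - {i}"] Suc.hyps(2)[symmetric] Suc.prems i
      by (simp add: vandermonde_det_eq_det_rows inj_on_diff)
    then show "(-1) ^ above J i * a i ^ (card J - 1) * det_rows (\<lambda>i s. a i ^ s) (J - {i}) =
        (-1) ^ above J i * a i ^ m * pair_prod ?F (J - {i})"
      using Suc.hyps(2)[symmetric] by simp
  qed
  also have "\<dots> = (\<Sum>i\<in>J. pair_prod ?F J * (a i ^ m / (\<Prod>k\<in>J - {i}. a i - a k)))"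
  proof (rule sum.cong[OF refl])
    fix i assume i: "i \<in> J"
    show "(-1) ^ above J i * a i ^ m * pair_prod ?F (J - {i}) =
        pair_prod ?F J * (a i ^ m / (\<Prod>k\<in>J - {i}. a i - a k))"
      using nz[OF i] pair_prod_remove_antisym[OF Suc.prems(1) i, of ?F] by simp
  qed
  also have "\<dots> = pair_prod ?F J * (\<Sum>i\<in>J. a i ^ m / (\<Prod>k\<in>J - {i}. a i - a k))"
    by (simp add: sum_distrib_left)
  also have "(\<Sum>i\<in>J. a i ^ m / (\<Prod>k\<in>J - {i}. a i - a k)) = 1"
    using sum_interpolation_extra_nodes[of J "{}" a "monom 1 m"] Suc.prems Suc.hyps(2)[symmetric]
    by (simp add: degree_monom_eq poly_monom)
  finally show ?case by simp
qed

section \<open>Recurrences for the coefficients of a single subset\<close>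

text \<open>
  The values \<open>0\<close> and \<open>-1\<close> are excluded because they serve as interpolation nodes next to the \<open>a i\<close>.
  The condition on products covers \<open>a i \<noteq> 1\<close> and \<open>a i * a j \<noteq> 1\<close>; for larger \<open>J\<close> it is what
  forces the sum of the coefficients to vanish.
\<close>

definition generic :: "(nat \<Rightarrow> complex) \<Rightarrow> nat set \<Rightarrow> bool" where
  "generic a I \<longleftrightarrow> finite I \<and> inj_on a I \<and> 0 \<notin> a ` I \<and> -1 \<notin> a ` I \<and>
    (\<forall>J\<subseteq>I. J \<noteq> {} \<longrightarrow> prod a J \<noteq> 1)"

lemma generic_subset:
  assumes gen: "generic a I" and sub: "J \<subseteq> I"
  shows "generic a J"
  using gen finite_subset[OF sub] inj_on_subset[of a I, OF _ sub] sub
  by (auto simp: generic_def)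

lemma generic_mult_neq_1:
  assumes "generic a I" "i \<in> I" "j \<in> I" "i \<noteq> j"
  shows "a i * a j \<noteq> 1"
proof -
  have "{i, j} \<subseteq> I" "{i, j} \<noteq> {}" using assms(2,3) by simp_all
  then have "prod a {i, j} \<noteq> 1" using assms(1) unfolding generic_def by blast
  then show ?thesis using assms by simp
qed

lemma gam_eq_pair_prod:
  assumes "finite J" "inj_on a J"
  shows "gam a J = pair_prod (\<lambda>i j. a j - a i) J / pair_prod (\<lambda>i j. a i * a j - 1) J"
  using vandermonde_det_eq_pair_prod[OF assms] by (simp add: gam_def pair_prod_def)

text \<open>
  Both pair products in \<open>gam\<close> lose the factors that involve \<open>i\<close>; bringing the differences among them
  into the form \<open>a i - a k\<close> costs one sign for each \<open>k\<close> above \<open>i\<close>.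
\<close>

lemma gam_remove:
  assumes gen: "generic a J" and i: "i \<in> J"
  shows "(-1) ^ above J i * gam a (J - {i}) =
    gam a J * (\<Prod>k\<in>J - {i}. (a i * a k - 1) / (a i - a k))"
proof -
  have fin: "finite J" and inj: "inj_on a J" using gen by (auto simp: generic_def)
  have "(\<Prod>k\<in>J - {i}. a i - a k) \<noteq> 0" using fin inj i by (auto simp: inj_on_def)
  moreover have "(\<Prod>k\<in>J - {i}. a i * a k - 1) \<noteq> 0"
    using fin generic_mult_neq_1[OF gen i] by fastforce
  ultimately show ?thesis
    using pair_prod_remove_antisym[OF fin i, of "\<lambda>i j. a j - a i"]
      pair_prod_remove_sym[OF fin i, of "\<lambda>i j. a i * a j - 1"]
    by (simp add: gam_eq_pair_prod fin inj inj_on_diff prod_dividef mult.commute)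
qed

lemma
  fixes a :: "nat \<Rightarrow> complex"
  assumes fin: "finite J" and nz: "\<And>j. j \<in> J \<Longrightarrow> a j \<noteq> 0"
  shows degree_prod_reciprocal: "degree (\<Prod>j\<in>J. [:-1, a j:]) = card J"
    and coeff_prod_reciprocal: "coeff (\<Prod>j\<in>J. [:-1, a j:]) (card J) = prod a J"
proof -
  show deg: "degree (\<Prod>j\<in>J. [:-1, a j:]) = card J"
    using fin nz by (subst degree_prod_eq_sum_degree) auto
  have "lead_coeff (\<Prod>j\<in>J. [:-1, a j:]) = prod a J"
    unfolding lead_coeff_prod using nz by (intro prod.cong) auto
  then show "coeff (\<Prod>j\<in>J. [:-1, a j:]) (card J) = prod a J" using deg by simp
qed

text \<open>
  The factor of \<open>j = i\<close> is \<open>a i ^ 2 - 1\<close>. Its factor \<open>a i + 1\<close> cancels against the difference from the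
  extra node \<open>-1\<close>, which is the reason for the choice of that node.
\<close>

lemma poly_prod_reciprocal_node:
  fixes a :: "nat \<Rightarrow> complex"
  assumes "finite J" "i \<in> J"
  shows "poly (\<Prod>j\<in>J. [:-1, a j:]) (a i) = (a i - 1) * (a i + 1) * (\<Prod>k\<in>J - {i}. a i * a k - 1)"
  using assms by (subst prod.remove[of J i]) (simp_all add: poly_prod algebra_simps)

lemma poly_prod_reciprocal_minus_1:
  "poly (\<Prod>j\<in>J. [:-1, a j:]) (-1) = (\<Prod>j\<in>J. -1 - a j :: complex)"
  unfolding poly_prod by (intro prod.cong) simp_all

text \<open>
  Interpolating \<open>\<Prod>j\<in>J. (z * a j - 1)\<close> at the \<open>a i\<close> and at \<open>-1\<close> uses one node more than the degree, so the
  sum is the leading coefficient \<open>prod a J\<close>; the node \<open>-1\<close> contributes \<open>1\<close>.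
\<close>

lemma sum_partial_fractions:
  assumes gen: "generic a J"
  shows "(\<Sum>i\<in>J. (a i - 1) * (\<Prod>k\<in>J - {i}. (a i * a k - 1) / (a i - a k))) = prod a J - 1"
proof -
  let ?p = "\<Prod>j\<in>J. [:-1, a j:]"
  let ?s = "\<lambda>i. poly ?p (a i) / ((\<Prod>z\<in>{-1}. a i - z) * (\<Prod>k\<in>J - {i}. a i - a k))"
  have fin: "finite J" and inj: "inj_on a J" and nm: "-1 \<notin> a ` J"
    and nz: "\<And>j. j \<in> J \<Longrightarrow> a j \<noteq> 0"
    using gen by (force simp: generic_def)+
  have nz': "(\<Prod>j\<in>J. -1 - a j) \<noteq> 0" using fin nm by auto
  have disj: "{-1} \<inter> a ` J = {}" using nm by blast
  have "sum ?s J + (\<Sum>z\<in>{-1}. poly ?p z / ((\<Prod>y\<in>{-1} - {z}. z - y) * (\<Prod>j\<in>J. z - a j))) =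
      coeff ?p (card J)"
    using sum_interpolation_extra_nodes[OF fin _ inj disj, of ?p] fin nz
    by (simp add: degree_prod_reciprocal)
  also have "(\<Sum>z\<in>{-1}. poly ?p z / ((\<Prod>y\<in>{-1} - {z}. z - y) * (\<Prod>j\<in>J. z - a j))) = 1"
    using nz' by (simp add: poly_prod_reciprocal_minus_1)
  also have "coeff ?p (card J) = prod a J"
    using fin nz by (rule coeff_prod_reciprocal)
  finally have "sum ?s J = prod a J - 1" by (simp add: eq_diff_eq)
  moreover have "?s i = (a i - 1) * (\<Prod>k\<in>J - {i}. (a i * a k - 1) / (a i - a k))" if i: "i \<in> J" for i
  proof -
    have "a i + 1 \<noteq> 0" using nm i by (metis add_eq_0_iff2 imageI)
    then show ?thesis
      by (simp add: poly_prod_reciprocal_node[OF fin i] prod_dividef)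
  qed
  ultimately show ?thesis by (simp cong: sum.cong)
qed

text \<open>
  Adding the node \<open>0\<close> gives two nodes more than the degree, so the interpolation sum vanishes. The
  nodes \<open>0\<close> and \<open>-1\<close> contribute \<open>1 / prod a J\<close> and \<open>-1\<close>. The result is the previous identity
  for the inverses of the \<open>a i\<close>, multiplied by \<open>prod a J\<close>.
\<close>

lemma sum_partial_fractions_dual:
  assumes gen: "generic a J"
  shows "(\<Sum>i\<in>J. (1 - a i) * prod a (J - {i}) * (\<Prod>k\<in>J - {i}. (a i * a k - 1) / (a i - a k))) =
    1 - prod a J"
proof -
  let ?p = "\<Prod>j\<in>J. [:-1, a j:]" and ?Z = "{0, -1} :: complex set"
  let ?s = "\<lambda>i. poly ?p (a i) / ((\<Prod>z\<in>?Z. a i - z) * (\<Prod>k\<in>J - {i}. a i - a k))"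
  have fin: "finite J" and inj: "inj_on a J" and nm: "-1 \<notin> a ` J"
    and nz: "\<And>j. j \<in> J \<Longrightarrow> a j \<noteq> 0"
    using gen by (force simp: generic_def)+
  have nz': "(\<Prod>j\<in>J. -1 - a j) \<noteq> 0" using fin nm by auto
  have A: "prod a J \<noteq> 0" using fin nz by auto
  have disj: "?Z \<inter> a ` J = {}" using nm nz by auto
  have deg: "degree ?p = card J" using fin nz by (rule degree_prod_reciprocal)
  have "coeff ?p (card ?Z + card J - 1) = 0"
    by (rule coeff_eq_0) (simp add: deg)
  then have "sum ?s J +
      (\<Sum>z\<in>?Z. poly ?p z / ((\<Prod>y\<in>?Z - {z}. z - y) * (\<Prod>j\<in>J. z - a j))) = 0"
    using sum_interpolation_extra_nodes[OF fin _ inj disj, of ?p] deg by simp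
  also have "(\<Sum>z\<in>?Z. poly ?p z / ((\<Prod>y\<in>?Z - {z}. z - y) * (\<Prod>j\<in>J. z - a j))) =
      1 / prod a J - 1"
  proof -
    have Z: "?Z - {0} = {-1}" "?Z - {-1} = {0}" by auto
    have "(\<Prod>j\<in>J. - a j) = (-1) ^ card J * prod a J" by (rule prod_uminus)
    then have "poly ?p 0 / ((\<Prod>y\<in>?Z - {0}. 0 - y) * (\<Prod>j\<in>J. 0 - a j)) = 1 / prod a J"
      unfolding Z using A by (simp add: poly_prod)
    moreover have "poly ?p (-1) / ((\<Prod>y\<in>?Z - {-1}. -1 - y) * (\<Prod>j\<in>J. -1 - a j)) = -1"
      unfolding Z poly_prod_reciprocal_minus_1 using nz' by simp
    ultimately show ?thesis by simp
  qed
  finally have sum: "sum ?s J = 1 - 1 / prod a J" by (simp add: algebra_simps eq_diff_eq)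
  have "(1 - a i) * prod a (J - {i}) * (\<Prod>k\<in>J - {i}. (a i * a k - 1) / (a i - a k)) =
      - prod a J * ?s i" if i: "i \<in> J" for i
  proof -
    define P Q where "P = (\<Prod>k\<in>J - {i}. a i * a k - 1)" and "Q = (\<Prod>k\<in>J - {i}. a i - a k)"
    have "a i + 1 \<noteq> 0" "a i \<noteq> 0" using nm i nz by (metis add_eq_0_iff2 imageI, blast)
    moreover have "prod a J = a i * prod a (J - {i})" using fin i by (rule prod.remove)
    moreover have "(\<Prod>k\<in>J - {i}. (a i * a k - 1) / (a i - a k)) = P / Q"
      by (simp add: P_def Q_def prod_dividef)
    moreover have "?s i = (a i - 1) * P / (a i * Q)"
    proof -
      have "?s i = (a i - 1) * (a i + 1) * P / (a i * (a i + 1) * Q)"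
        by (simp add: poly_prod_reciprocal_node[OF fin i] P_def Q_def)
      then show ?thesis using \<open>a i + 1 \<noteq> 0\<close> by simp
    qed
    moreover have "(1 - x) * B * (P / Q) = - (x * B) * ((x - 1) * P / (x * Q))"
      if "x \<noteq> 0" for x B
      using that by (cases "Q = 0") (simp_all add: field_simps)
    ultimately show ?thesis by presburger
  qed
  then have "(\<Sum>i\<in>J. (1 - a i) * prod a (J - {i}) * (\<Prod>k\<in>J - {i}. (a i * a k - 1) / (a i - a k))) =
      - prod a J * sum ?s J"
    unfolding sum_distrib_left by (intro sum.cong refl)
  also have "\<dots> = 1 - prod a J"
    unfolding sum using A by (simp add: right_diff_distrib)
  finally show ?thesis .
qed

lemma gam_recurrence:
  assumes gen: "generic a J"
  shows "(\<Sum>i\<in>J. (-1) ^ above J i * (a i - 1) * gam a (J - {i})) = gam a J * (prod a J - 1)"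
proof -
  have "(\<Sum>i\<in>J. (-1) ^ above J i * (a i - 1) * gam a (J - {i})) =
      (\<Sum>i\<in>J. gam a J * ((a i - 1) * (\<Prod>k\<in>J - {i}. (a i * a k - 1) / (a i - a k))))"
    using gam_remove[OF gen] by (intro sum.cong) (simp_all add: mult_ac)
  then show ?thesis
    by (simp only: sum_distrib_left[symmetric] sum_partial_fractions[OF gen])
qed

lemma gam_recurrence_dual:
  assumes gen: "generic a J"
  shows "(\<Sum>i\<in>J. (-1) ^ above J i * ((1 - a i) * prod a (J - {i})) * gam a (J - {i})) =
    gam a J * (1 - prod a J)"
proof -
  have "(\<Sum>i\<in>J. (-1) ^ above J i * ((1 - a i) * prod a (J - {i})) * gam a (J - {i})) =
      (\<Sum>i\<in>J. gam a J *
        ((1 - a i) * prod a (J - {i}) * (\<Prod>k\<in>J - {i}. (a i * a k - 1) / (a i - a k))))"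
    using gam_remove[OF gen] by (intro sum.cong) (simp_all add: mult_ac)
  then show ?thesis
    by (simp only: sum_distrib_left[symmetric] sum_partial_fractions_dual[OF gen])
qed

section \<open>Summation over all subsets\<close>

text \<open>
  The exponent is the sum of the elements of \<open>K\<close>, each replaced by its 1-based rank in \<open>I\<close>: for \<open>I = {1..n}\<close> it
  is \<open>nu K\<close>, and removing an element from \<open>I\<close> stays within the definition.
\<close>

definition rank_sign :: "nat set \<Rightarrow> nat set \<Rightarrow> complex" where
  "rank_sign I K = (-1) ^ (\<Sum>k\<in>K. card {l \<in> I. l \<le> k})"

text \<open>
  Removing \<open>i\<close> from \<open>I\<close> lowers the rank of exactly those elements that are above \<open>i\<close>.
\<close>

lemma rank_sign_remove:
  assumes fin: "finite I" and K: "K \<subseteq> I" and i: "i \<in> I" "i \<notin> K"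
  shows "rank_sign I K = rank_sign (I - {i}) K * (-1) ^ above K i"
proof -
  have finK: "finite K" using K fin by (rule finite_subset)
  have "card {l \<in> I. l \<le> k} = card {l \<in> I - {i}. l \<le> k} + of_bool (i < k)" if "k \<in> K" for k
  proof (cases "i < k")
    case True
    then have "{l \<in> I. l \<le> k} = insert i {l \<in> I - {i}. l \<le> k}" using i by auto
    then show ?thesis using True fin by simp
  next
    case False
    then have "{l \<in> I. l \<le> k} = {l \<in> I - {i}. l \<le> k}" using i that by (auto simp: le_less)
    then show ?thesis using False by simp
  qed
  then have "(\<Sum>k\<in>K. card {l \<in> I. l \<le> k}) =
      (\<Sum>k\<in>K. card {l \<in> I - {i}. l \<le> k}) + (\<Sum>k\<in>K. of_bool (i < k))"
    by (simp add: sum.distrib)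
  also have "(\<Sum>k\<in>K. of_bool (i < k)) = above K i"
    using finK by (simp add: above_def of_bool_def sum.If_cases Int_def)
  finally show ?thesis by (simp add: rank_sign_def power_add)
qed

lemma above_Diff:
  assumes "finite I" "J \<subseteq> I"
  shows "above I i = above J i + above (I - J) i"
proof -
  have "{k \<in> I. i < k} = {k \<in> J. i < k} \<union> {k \<in> I - J. i < k}" using assms by auto
  moreover have "card ({k \<in> J. i < k} \<union> {k \<in> I - J. i < k}) =
      card {k \<in> J. i < k} + card {k \<in> I - J. i < k}"
    using assms finite_subset[OF assms(2,1)] by (intro card_Un_disjoint) auto
  ultimately show ?thesis by (simp add: above_def)
qed

lemma rank_sign_complement:
  assumes "finite I" "J \<subseteq> I"
  shows "rank_sign I J * rank_sign I (I - J) = rank_sign I I"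
  using assms sum.subset_diff[OF assms(2,1), of "\<lambda>k. card {l \<in> I. l \<le> k}"]
  by (simp add: rank_sign_def power_add mult.commute)

definition subset_coeff :: "(nat \<Rightarrow> complex) \<Rightarrow> nat set \<Rightarrow> nat set \<Rightarrow> complex" where
  "subset_coeff a I J = rank_sign I (I - J) * gam a J * gam a (I - J)"

text \<open>
  Exchange of the summations over \<open>J\<close> and \<open>i \<in> J\<close>, with \<open>J = insert i K\<close>. The signs fit together
  because the elements of \<open>I\<close> above \<open>i\<close> are those of \<open>J\<close>, which are counted by the sign on the left,
  and those of \<open>I - J\<close>, whose ranks change when \<open>i\<close> is removed.
\<close>

lemma sum_subsets_remove:
  assumes fin: "finite I"
  shows "(\<Sum>J\<in>Pow I. rank_sign I (I - J) * gam a (I - J) *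
        (\<Sum>i\<in>J. (-1) ^ above J i * g i * gam a (J - {i})) * h J) =
    (\<Sum>i\<in>I. (-1) ^ above I i * g i *
        (\<Sum>K\<in>Pow (I - {i}). subset_coeff a (I - {i}) K * h (insert i K)))"
proof -
  let ?t = "\<lambda>J i. rank_sign I (I - J) * gam a (I - J) *
        ((-1) ^ above J i * g i * gam a (J - {i})) * h J"
  have "(\<Sum>J\<in>Pow I. rank_sign I (I - J) * gam a (I - J) *
        (\<Sum>i\<in>J. (-1) ^ above J i * g i * gam a (J - {i})) * h J) =
      (\<Sum>J\<in>Pow I. \<Sum>i\<in>{i. i \<in> I \<and> i \<in> J}. ?t J i)"
    by (intro sum.cong[OF refl]) (auto simp: sum_distrib_left sum_distrib_right intro!: sum.cong)
  also have "\<dots> = (\<Sum>i\<in>I. \<Sum>J\<in>{J. J \<in> Pow I \<and> i \<in> J}. ?t J i)"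
    using fin by (intro sum.swap_restrict) auto
  also have "\<dots> = (\<Sum>i\<in>I. \<Sum>K\<in>Pow (I - {i}). (-1) ^ above I i * g i *
        (subset_coeff a (I - {i}) K * h (insert i K)))"
  proof (rule sum.cong[OF refl])
    fix i assume i: "i \<in> I"
    have "(\<Sum>J\<in>{J. J \<in> Pow I \<and> i \<in> J}. ?t J i) = (\<Sum>K\<in>Pow (I - {i}). ?t (insert i K) i)"
      by (rule sum.reindex_bij_witness[of _ "insert i" "\<lambda>J. J - {i}"]) (use i in \<open>auto simp: insert_absorb\<close>)
    also have "\<dots> = (\<Sum>K\<in>Pow (I - {i}). (-1) ^ above I i * g i *
        (subset_coeff a (I - {i}) K * h (insert i K)))"
    proof (rule sum.cong[OF refl])
      fix K assume "K \<in> Pow (I - {i})"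
      then have K: "K \<subseteq> I - {i}" by simp
      have J: "insert i K \<subseteq> I" and diff: "insert i K - {i} = K" "I - {i} - K = I - insert i K"
        using K i by auto
      have "rank_sign I (I - insert i K) * (-1) ^ above (insert i K) i =
          rank_sign (I - {i}) (I - insert i K) * (-1) ^ above I i"
        using rank_sign_remove[OF fin, of "I - insert i K" i] above_Diff[OF fin J, of i] i
        by (simp add: power_add mult_ac)
      then show "?t (insert i K) i = (-1) ^ above I i * g i *
          (subset_coeff a (I - {i}) K * h (insert i K))"
        by (simp add: subset_coeff_def diff mult_ac)
    qed
    finally show "(\<Sum>J\<in>{J. J \<in> Pow I \<and> i \<in> J}. ?t J i) =
        (\<Sum>K\<in>Pow (I - {i}). (-1) ^ above I i * g i *
        (subset_coeff a (I - {i}) K * h (insert i K)))" .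
  qed
  finally show ?thesis by (simp add: sum_distrib_left)
qed

text \<open>
  The factor \<open>prod a J - 1\<close> is the difference in \<open>N\<close> of the exponential of \<open>J\<close>, so this is the recursion
  for the whole combination of exponentials. For \<open>h = (\<lambda>_. 1)\<close> it compares the values at \<open>N = 0\<close> and \<open>N = 1\<close>.
\<close>

lemma sum_subset_coeff_mult_diff:
  assumes gen: "generic a I"
  shows "(\<Sum>J\<in>Pow I. subset_coeff a I J * (prod a J - 1) * h J) =
    (\<Sum>i\<in>I. (-1) ^ above I i * (a i - 1) *
        (\<Sum>K\<in>Pow (I - {i}). subset_coeff a (I - {i}) K * h (insert i K)))"
proof -
  have fin: "finite I" using gen by (simp add: generic_def)
  have "subset_coeff a I J * (prod a J - 1) * h J =
      rank_sign I (I - J) * gam a (I - J) *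
        (\<Sum>i\<in>J. (-1) ^ above J i * (a i - 1) * gam a (J - {i})) * h J"
    if "J \<in> Pow I" for J
  proof -
    have "generic a J" using gen that by (auto intro: generic_subset)
    then show ?thesis by (simp only: gam_recurrence) (simp add: subset_coeff_def)
  qed
  then show ?thesis
    using sum_subsets_remove[OF fin, of a "\<lambda>i. a i - 1" h] by (simp only: cong: sum.cong)
qed

text \<open>
  For \<open>i \<in> J\<close>, multiplication by \<open>prod a (I - J)\<close> turns the factor \<open>prod a (J - {i})\<close> of the dual
  recurrence into \<open>prod a (I - {i})\<close>, which no longer depends on \<open>J\<close>.
\<close>

lemma sum_subset_coeff_complement:
  assumes gen: "generic a I"
  shows "(\<Sum>J\<in>Pow I. subset_coeff a I J * (1 - prod a J) * prod a (I - J)) =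
    (\<Sum>i\<in>I. (-1) ^ above I i * ((1 - a i) * prod a (I - {i})) *
        (\<Sum>K\<in>Pow (I - {i}). subset_coeff a (I - {i}) K))"
proof -
  have fin: "finite I" using gen by (simp add: generic_def)
  have "subset_coeff a I J * (1 - prod a J) * prod a (I - J) =
      rank_sign I (I - J) * gam a (I - J) *
        (\<Sum>i\<in>J. (-1) ^ above J i * ((1 - a i) * prod a (I - {i})) * gam a (J - {i})) * 1"
    if "J \<in> Pow I" for J
  proof -
    have J: "J \<subseteq> I" and finJ: "finite J" using that fin finite_subset by auto
    have "(1 - a i) * prod a (I - {i}) = (1 - a i) * prod a (J - {i}) * prod a (I - J)" if "i \<in> J" for i
    proof -
      have "I - {i} - (J - {i}) = I - J" using that by auto
      then show ?thesis
        using prod.subset_diff[of "J - {i}" "I - {i}" a] J fin by (simp add: Diff_mono mult_ac)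
    qed
    then have "(\<Sum>i\<in>J. (-1) ^ above J i * ((1 - a i) * prod a (I - {i})) * gam a (J - {i})) =
        (\<Sum>i\<in>J. (-1) ^ above J i * ((1 - a i) * prod a (J - {i})) * gam a (J - {i})) * prod a (I - J)"
      unfolding sum_distrib_right by (intro sum.cong refl) (simp only: mult_ac)
    also have "\<dots> = gam a J * (1 - prod a J) * prod a (I - J)"
      by (simp only: gam_recurrence_dual[OF generic_subset[OF gen J]])
    finally show ?thesis by (simp only:) (simp add: subset_coeff_def)
  qed
  then show ?thesis
    using sum_subsets_remove[OF fin, of a "\<lambda>i. (1 - a i) * prod a (I - {i})" "\<lambda>_. 1"]
    by (simp only: mult_1_right cong: sum.cong)
qed

lemma gam_empty [simp]: "gam a {} = 1"
  by (simp add: gam_def vandermonde_det_eq_det_rows)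

lemma gam_singleton [simp]: "gam a {i} = 1"
proof -
  have "pair_prod F {i} = 1" for F :: "nat \<Rightarrow> nat \<Rightarrow> complex"
    unfolding pair_prod_def by (rule prod.neutral) auto
  then show ?thesis by (simp add: gam_eq_pair_prod)
qed

lemma sum_Pow_complement:
  "(\<Sum>J\<in>Pow I. f (I - J)) = (\<Sum>J\<in>Pow I. f J)"
  by (rule sum.reindex_bij_witness[of _ "\<lambda>J. I - J" "\<lambda>J. I - J"]) (auto simp: double_diff)

text \<open>
  With \<open>T\<close> for the sum, \<open>c J\<close> for the coefficients and the statement known for all \<open>I - {i}\<close>, the two
  recurrences give \<open>(\<Sum>J. c J * prod a J) = T\<close> and \<open>(\<Sum>J. c J * prod a (I - J)) = prod a I * T\<close>. Passing to
  complements identifies the two left-hand sides up to a sign that also fixes \<open>T\<close>. Singletons are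
  treated separately, because \<open>I - {i}\<close> is empty there and the sum over subsets of the empty set is \<open>1\<close>.
\<close>

lemma sum_subset_coeff_eq_0:
  assumes "generic a I" "I \<noteq> {}"
  shows "(\<Sum>J\<in>Pow I. subset_coeff a I J) = 0"
  using assms
proof (induction "card I" arbitrary: I rule: less_induct)
  case less
  note gen = less.prems(1)
  have fin: "finite I" using gen by (simp add: generic_def)
  show ?case
  proof (cases "\<exists>i. I = {i}")
    case True
    then obtain i where i: "I = {i}" by blast
    have "{l. l = i \<and> l \<le> i} = {i}" by auto
    then show ?thesis by (simp add: i Pow_insert subset_coeff_def rank_sign_def)
  next
    case False
    let ?T = "\<Sum>J\<in>Pow I. subset_coeff a I J"
    have T_smaller: "(\<Sum>K\<in>Pow (I - {i}). subset_coeff a (I - {i}) K) = 0" if i: "i \<in> I" for i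
    proof (rule less.hyps)
      show "card (I - {i}) < card I" using fin i by (rule card_Diff1_less)
      show "generic a (I - {i})" using gen by (rule generic_subset) auto
      show "I - {i} \<noteq> {}" using False i by blast
    qed
    have "(\<Sum>J\<in>Pow I. subset_coeff a I J * (prod a J - 1)) = 0"
      using sum_subset_coeff_mult_diff[OF gen, of "\<lambda>_. 1"] T_smaller by simp
    then have T1: "(\<Sum>J\<in>Pow I. subset_coeff a I J * prod a J) = ?T"
      by (simp add: algebra_simps sum_subtractf)
    have "subset_coeff a I J * (1 - prod a J) * prod a (I - J) =
        subset_coeff a I J * prod a (I - J) - prod a I * subset_coeff a I J" if "J \<in> Pow I" for J
      using prod.subset_diff[of J I a] that fin by (simp add: algebra_simps)
    then have "(\<Sum>J\<in>Pow I. subset_coeff a I J * prod a (I - J) - prod a I * subset_coeff a I J) =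
        (\<Sum>J\<in>Pow I. subset_coeff a I J * (1 - prod a J) * prod a (I - J))"
      by (intro sum.cong) simp_all
    also have "\<dots> = 0"
      unfolding sum_subset_coeff_complement[OF gen] using T_smaller by simp
    finally have T2: "(\<Sum>J\<in>Pow I. subset_coeff a I J * prod a (I - J)) = prod a I * ?T"
      by (simp add: sum_subtractf sum_distrib_left)
    \<comment> \<open>Complementation swaps the two factors \<open>gam\<close> and changes only the sign, uniformly in \<open>J\<close>.\<close>
    have flip: "subset_coeff a I J = rank_sign I I * subset_coeff a I (I - J)" if "J \<in> Pow I" for J
    proof -
      have "rank_sign I I * rank_sign I J =
          (rank_sign I J * rank_sign I J) * rank_sign I (I - J)"
        using rank_sign_complement[OF fin, of J] that by simp
      also have "rank_sign I J * rank_sign I J = 1"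
        by (simp add: rank_sign_def flip: power_mult_distrib)
      finally show ?thesis using that by (simp add: subset_coeff_def double_diff)
    qed
    have "?T = (\<Sum>J\<in>Pow I. rank_sign I I * subset_coeff a I (I - J))"
      by (rule sum.cong[OF refl]) (rule flip)
    also have "\<dots> = rank_sign I I * ?T"
      by (simp only: sum_distrib_left[symmetric] sum_Pow_complement)
    finally have T: "rank_sign I I * ?T = ?T" by (rule sym)
    have "prod a I * ?T = (\<Sum>J\<in>Pow I. subset_coeff a I J * prod a (I - J))"
      by (simp only: T2)
    also have "\<dots> = (\<Sum>J\<in>Pow I. rank_sign I I * (subset_coeff a I (I - J) * prod a (I - J)))"
    proof (rule sum.cong[OF refl])
      fix J assume "J \<in> Pow I"
      from flip[OF this] show "subset_coeff a I J * prod a (I - J) =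
          rank_sign I I * (subset_coeff a I (I - J) * prod a (I - J))"
        by (simp only: mult.assoc)
    qed
    also have "\<dots> = rank_sign I I * (\<Sum>J\<in>Pow I. subset_coeff a I J * prod a J)"
      by (simp only: sum_distrib_left[symmetric]
          sum_Pow_complement[of "\<lambda>J. subset_coeff a I J * prod a J"])
    also have "\<dots> = ?T" by (simp only: T1 T)
    finally have "prod a I * ?T = ?T" .
    moreover have "prod a I \<noteq> 1" using gen less.prems(2) unfolding generic_def by blast
    ultimately show ?thesis by simp
  qed
qed

section \<open>The sum of determinants over increasing tuples\<close>

lemma det_rows_cong:
  assumes "\<And>i s. i \<in> I \<Longrightarrow> s < card I \<Longrightarrow> f i s = g i s"
  shows "det_rows f I = det_rows g I"
proof (cases "finite I")
  case True
  have "sorted_list_of_set I ! r \<in> I" if "r < card I" for r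
    using that True nth_mem[of r "sorted_list_of_set I"] by simp
  then have "mat (card I) (card I) (\<lambda>(r, s). f (sorted_list_of_set I ! r) s) =
      mat (card I) (card I) (\<lambda>(r, s). g (sorted_list_of_set I ! r) s)"
    using assms by (intro cong_mat) simp_all
  then show ?thesis by (simp only: det_rows_def)
qed (simp add: det_rows_def)

definition det_sum :: "(nat \<Rightarrow> complex) \<Rightarrow> nat set \<Rightarrow> nat \<Rightarrow> complex" where
  "det_sum a I N = (\<Sum>x\<in>increasing_tuples (card I) N. det_rows (\<lambda>i s. a i ^ x (s + 1)) I)"

lemma finite_increasing_tuples: "finite (increasing_tuples n N)"
  unfolding increasing_tuples_def
  by (rule finite_subset[OF _ finite_PiE[of "{1..n}" "\<lambda>_. {1..N}"]]) auto

lemma increasing_tuples_0_left: "increasing_tuples 0 N = {\<lambda>_. undefined}"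
  by (auto simp: increasing_tuples_def strict_mono_on_def)

lemma increasing_tuples_0_right:
  assumes "n > 0"
  shows "increasing_tuples n 0 = {}"
proof -
  have "x \<notin> {1..n} \<rightarrow>\<^sub>E {1..0}" for x :: "nat \<Rightarrow> nat"
    using PiE_mem[of x "{1..n}" "\<lambda>_. {1..0}" 1] assms by auto
  then show ?thesis by (simp add: increasing_tuples_def)
qed

text \<open>
  Tuples that end below \<open>Suc N\<close> and tuples that end in \<open>Suc N\<close>. In a shorter tuple the position
  \<open>Suc m\<close> carries the value \<open>undefined\<close> of extensional functions, so updating it loses nothing.
\<close>

lemma increasing_tuples_Suc:
  "increasing_tuples (Suc m) (Suc N) = increasing_tuples (Suc m) N \<union>
    (\<lambda>x. x(Suc m := Suc N)) ` increasing_tuples m N" (is "?L = ?A \<union> ?B")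
proof (intro equalityI subsetI)
  fix x assume x: "x \<in> ?L"
  have range: "x k \<in> {1..Suc N}" if "k \<in> {1..Suc m}" for k
    using x that PiE_mem unfolding increasing_tuples_def by blast
  have undef: "x k = undefined" if "k \<notin> {1..Suc m}" for k
    using x that PiE_arb unfolding increasing_tuples_def by blast
  have mono: "x i < x j" if "i \<in> {1..Suc m}" "j \<in> {1..Suc m}" "i < j" for i j
    using x that strict_mono_onD[of "{1..Suc m}" x i j] by (simp add: increasing_tuples_def)
  have less: "x k < x (Suc m)" if "k \<in> {1..m}" for k
    using that mono[of k "Suc m"] by simp
  show "x \<in> ?A \<union> ?B"
  proof (cases "x (Suc m) = Suc N")
    case True
    \<comment> \<open>The truncated tuple has to be extensional on the smaller index range.\<close>
    let ?y = "x(Suc m := undefined)"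
    have "?y \<in> {1..m} \<rightarrow>\<^sub>E {1..N}"
    proof (rule PiE_I)
      fix k assume k: "k \<in> {1..m}"
      then have "k \<in> {1..Suc m}" "k \<noteq> Suc m" by simp_all
      then show "?y k \<in> {1..N}" using range[of k] less[OF k] True by simp
    next
      fix k assume "k \<notin> {1..m}"
      then have "k = Suc m \<or> k \<notin> {1..Suc m}" by auto
      then show "?y k = undefined" using undef[of k] by (cases "k = Suc m") simp_all
    qed
    moreover have "strict_mono_on {1..m} ?y"
      using mono by (auto intro!: strict_mono_onI)
    ultimately have "?y \<in> increasing_tuples m N" by (simp add: increasing_tuples_def)
    moreover have "x = ?y(Suc m := Suc N)" using True by auto
    ultimately show ?thesis by blast
  next
    case False
    have last: "x (Suc m) \<le> N" using range[of "Suc m"] False by simp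
    have "x k \<le> N" if "k \<in> {1..Suc m}" for k
    proof (cases "k = Suc m")
      case False
      then show ?thesis using that less[of k] last by simp
    qed (use last in simp)
    then have "x \<in> {1..Suc m} \<rightarrow>\<^sub>E {1..N}"
      using range undef by (intro PiE_I) auto
    then show ?thesis using x by (simp add: increasing_tuples_def)
  qed
next
  fix x assume "x \<in> ?A \<union> ?B"
  then show "x \<in> ?L"
  proof
    assume x: "x \<in> ?A"
    have "({1..Suc m} \<rightarrow>\<^sub>E {1..N}) \<subseteq> ({1..Suc m} \<rightarrow>\<^sub>E {1..Suc N})" by (rule PiE_mono) auto
    then show ?thesis using x unfolding increasing_tuples_def by blast
  next
    assume "x \<in> ?B"
    then obtain y where y: "y \<in> increasing_tuples m N" and x: "x = y(Suc m := Suc N)" by blast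
    have range: "y k \<in> {1..N}" if "k \<in> {1..m}" for k
      using y that PiE_mem unfolding increasing_tuples_def by blast
    have undef: "y k = undefined" if "k \<notin> {1..m}" for k
      using y that PiE_arb unfolding increasing_tuples_def by blast
    have mono: "y i < y j" if "i \<in> {1..m}" "j \<in> {1..m}" "i < j" for i j
      using y that strict_mono_onD[of "{1..m}" y i j] by (simp add: increasing_tuples_def)
    have "x \<in> {1..Suc m} \<rightarrow>\<^sub>E {1..Suc N}"
    proof (rule PiE_I)
      fix k assume "k \<in> {1..Suc m}"
      then have "k = Suc m \<or> k \<in> {1..m}" by auto
      then show "x k \<in> {1..Suc N}" using range[of k] x by (cases "k = Suc m") simp_all
    next
      fix k assume "k \<notin> {1..Suc m}"
      then have "k \<noteq> Suc m" "k \<notin> {1..m}" by auto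
      then show "x k = undefined" using undef[of k] x by simp
    qed
    moreover have "strict_mono_on {1..Suc m} x"
    proof (rule strict_mono_onI)
      fix i j assume ij: "i \<in> {1..Suc m}" "j \<in> {1..Suc m}" "i < j"
      then have i: "i \<in> {1..m}" by simp
      show "x i < x j"
      proof (cases "j = Suc m")
        case True
        then show ?thesis using range[OF i] i x by simp
      next
        case False
        then show ?thesis using mono[of i j] i ij x by simp
      qed
    qed
    ultimately show ?thesis by (simp add: increasing_tuples_def)
  qed
qed

lemma det_sum_empty: "det_sum a {} N = 1"
  by (simp add: det_sum_def increasing_tuples_0_left)

lemma det_sum_0: "finite I \<Longrightarrow> I \<noteq> {} \<Longrightarrow> det_sum a I 0 = 0"
  by (simp add: det_sum_def increasing_tuples_0_right card_gt_0_iff)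

text \<open>
  For the tuples that end in \<open>Suc N\<close>, the last column of the determinant is \<open>a i ^ Suc N\<close>, and the other
  columns form the determinants of the tuples of length \<open>card I - 1\<close>.
\<close>

lemma det_sum_Suc:
  assumes fin: "finite I" and ne: "I \<noteq> {}"
  shows "det_sum a I (Suc N) =
    det_sum a I N + (\<Sum>i\<in>I. (-1) ^ above I i * a i ^ Suc N * det_sum a (I - {i}) N)"
proof -
  define m where "m = card I - 1"
  have card: "card I = Suc m" using fin ne by (simp add: m_def card_gt_0_iff)
  let ?d = "\<lambda>I x. det_rows (\<lambda>i s. a i ^ x (s + 1)) I"
  let ?e = "\<lambda>x. x(Suc m := Suc N)"
  have range: "x (Suc m) \<in> {1..N}" if "x \<in> increasing_tuples (Suc m) N" for x
    using that PiE_mem[of x "{1..Suc m}" "\<lambda>_. {1..N}" "Suc m"] by (simp add: increasing_tuples_def)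
  have undef: "x (Suc m) = undefined" if "x \<in> increasing_tuples m N" for x
    using that PiE_arb[of x "{1..m}" "\<lambda>_. {1..N}" "Suc m"] by (simp add: increasing_tuples_def)
  have inj: "inj_on ?e (increasing_tuples m N)"
  proof (rule inj_onI)
    fix x y assume xy: "x \<in> increasing_tuples m N" "y \<in> increasing_tuples m N" "?e x = ?e y"
    have "x = (?e x)(Suc m := undefined)" using undef[OF xy(1)] by auto
    also have "\<dots> = (?e y)(Suc m := undefined)" by (simp only: xy(3))
    also have "\<dots> = y" using undef[OF xy(2)] by auto
    finally show "x = y" .
  qed
  have disj: "increasing_tuples (Suc m) N \<inter> ?e ` increasing_tuples m N = {}"
    using range by fastforce
  have "det_sum a I (Suc N) = sum (?d I) (increasing_tuples (Suc m) N) +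
      sum (?d I) (?e ` increasing_tuples m N)"
    unfolding det_sum_def card increasing_tuples_Suc
    by (intro sum.union_disjoint finite_imageI finite_increasing_tuples disj)
  also have "sum (?d I) (increasing_tuples (Suc m) N) = det_sum a I N"
    by (simp add: det_sum_def card)
  also have "sum (?d I) (?e ` increasing_tuples m N) = (\<Sum>x\<in>increasing_tuples m N. ?d I (?e x))"
    using inj by (simp add: sum.reindex)
  also have "\<dots> = (\<Sum>x\<in>increasing_tuples m N.
      \<Sum>i\<in>I. (-1) ^ above I i * a i ^ Suc N * ?d (I - {i}) x)"
  proof (rule sum.cong[OF refl])
    fix x
    have "?d (I - {i}) (?e x) = ?d (I - {i}) x" if "i \<in> I" for i
    proof (rule det_rows_cong)
      fix j s assume "s < card (I - {i})"
      then have "s + 1 \<noteq> Suc m" using fin that card by simp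
      then show "a j ^ (?e x) (s + 1) = a j ^ x (s + 1)" by simp
    qed
    then show "?d I (?e x) = (\<Sum>i\<in>I. (-1) ^ above I i * a i ^ Suc N * ?d (I - {i}) x)"
      unfolding det_rows_expand_last_column[OF fin ne] by (intro sum.cong) (simp_all add: card)
  qed
  also have "\<dots> = (\<Sum>i\<in>I. (-1) ^ above I i * a i ^ Suc N *
      (\<Sum>x\<in>increasing_tuples m N. ?d (I - {i}) x))"
    unfolding sum_distrib_left by (rule sum.swap)
  also have "\<dots> = (\<Sum>i\<in>I. (-1) ^ above I i * a i ^ Suc N * det_sum a (I - {i}) N)"
    using fin card by (intro sum.cong) (simp_all add: det_sum_def)
  finally show ?thesis .
qed

section \<open>The closed form satisfies the same recursion\<close>

definition exponential_sum :: "(nat \<Rightarrow> complex) \<Rightarrow> nat set \<Rightarrow> nat \<Rightarrow> complex" where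
  "exponential_sum a I N =
    (\<Prod>k\<in>I. a k / (a k - 1)) * (\<Sum>J\<in>Pow I. subset_coeff a I J * (\<Prod>j\<in>J. a j ^ N))"

lemma exponential_sum_0:
  assumes "generic a I" "I \<noteq> {}"
  shows "exponential_sum a I 0 = 0"
  using sum_subset_coeff_eq_0[OF assms] by (simp add: exponential_sum_def)

text \<open>
  The factor \<open>a i - 1\<close> from the recurrence of the coefficients cancels one denominator of the prefactor,
  which leaves the prefactor of \<open>I - {i}\<close> times \<open>a i\<close>.
\<close>

lemma exponential_sum_Suc:
  assumes gen: "generic a I"
  shows "exponential_sum a I (Suc N) = exponential_sum a I N +
    (\<Sum>i\<in>I. (-1) ^ above I i * a i ^ Suc N * exponential_sum a (I - {i}) N)"
proof -
  let ?P = "\<lambda>I. \<Prod>k\<in>I. a k / (a k - 1)"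
  have fin: "finite I" using gen by (simp add: generic_def)
  have "exponential_sum a I (Suc N) - exponential_sum a I N =
      ?P I * (\<Sum>J\<in>Pow I. subset_coeff a I J * (prod a J - 1) * (\<Prod>j\<in>J. a j ^ N))"
    unfolding exponential_sum_def right_diff_distrib[symmetric] sum_subtractf[symmetric]
    by (simp add: prod.distrib algebra_simps)
  also have "\<dots> = (\<Sum>i\<in>I. ?P I * ((-1) ^ above I i * (a i - 1) *
      (\<Sum>K\<in>Pow (I - {i}). subset_coeff a (I - {i}) K * (\<Prod>j\<in>insert i K. a j ^ N))))"
    unfolding sum_subset_coeff_mult_diff[OF gen] by (rule sum_distrib_left)
  also have "\<dots> = (\<Sum>i\<in>I. (-1) ^ above I i * a i ^ Suc N * exponential_sum a (I - {i}) N)"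
  proof (rule sum.cong[OF refl])
    fix i assume i: "i \<in> I"
    let ?S = "\<Sum>K\<in>Pow (I - {i}). subset_coeff a (I - {i}) K * (\<Prod>j\<in>K. a j ^ N)"
    have "prod a {i} \<noteq> 1" using gen i unfolding generic_def by blast
    then have ai: "a i - 1 \<noteq> 0" by simp
    have P: "?P I = a i / (a i - 1) * ?P (I - {i})" using fin i by (rule prod.remove)
    have S: "(\<Sum>K\<in>Pow (I - {i}). subset_coeff a (I - {i}) K * (\<Prod>j\<in>insert i K. a j ^ N)) =
        a i ^ N * ?S"
      unfolding sum_distrib_left
    proof (rule sum.cong[OF refl])
      fix K assume "K \<in> Pow (I - {i})"
      then have "finite K" "i \<notin> K" using fin finite_subset by auto
      then show "subset_coeff a (I - {i}) K * (\<Prod>j\<in>insert i K. a j ^ N) =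
          a i ^ N * (subset_coeff a (I - {i}) K * (\<Prod>j\<in>K. a j ^ N))" by simp
    qed
    show "?P I * ((-1) ^ above I i * (a i - 1) *
        (\<Sum>K\<in>Pow (I - {i}). subset_coeff a (I - {i}) K * (\<Prod>j\<in>insert i K. a j ^ N))) =
        (-1) ^ above I i * a i ^ Suc N * exponential_sum a (I - {i}) N"
      unfolding exponential_sum_def S P using ai by simp
  qed
  finally show ?thesis by (simp add: algebra_simps)
qed

lemma det_sum_eq_exponential_sum_generic:
  assumes "generic a I"
  shows "det_sum a I N = exponential_sum a I N"
  using assms
proof (induction N arbitrary: I)
  case 0
  show ?case
  proof (cases "I = {}")
    case True
    then show ?thesis
      by (simp add: det_sum_empty exponential_sum_def subset_coeff_def rank_sign_def)
  next
    case False
    moreover have "finite I" using 0 by (simp add: generic_def)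
    ultimately show ?thesis using 0 by (simp add: det_sum_0 exponential_sum_0)
  qed
next
  case (Suc N)
  show ?case
  proof (cases "I = {}")
    case True
    then show ?thesis
      by (simp add: det_sum_empty exponential_sum_def subset_coeff_def rank_sign_def)
  next
    case False
    have fin: "finite I" using Suc.prems by (simp add: generic_def)
    have "det_sum a (I - {i}) N = exponential_sum a (I - {i}) N" for i
      by (rule Suc.IH[OF generic_subset[OF Suc.prems]]) auto
    then show ?thesis
      by (simp only: det_sum_Suc[OF fin False] exponential_sum_Suc[OF Suc.prems] Suc.IH[OF Suc.prems])
  qed
qed

section \<open>Passage to the limit\<close>

lemma eventually_poly_neq_0:
  fixes p :: "complex poly"
  assumes "p \<noteq> 0"
  shows "eventually (\<lambda>t. poly p t \<noteq> 0) (at z)"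
proof -
  have "eventually (\<lambda>t. \<forall>r\<in>{r. poly p r = 0}. t \<noteq> r) (at z)"
    using poly_roots_finite[OF assms] by (intro eventually_ball_finite ballI eventually_neq_at_within)
  then show ?thesis by (rule eventually_mono) auto
qed

text \<open>
  Each of the finitely many conditions says that a nonzero polynomial in \<open>t\<close> does not vanish. The
  slopes \<open>i + 1\<close> are distinct, which separates the values, and nonzero, which makes every
  \<open>\<Prod>j\<in>J. (a j + t * (j + 1))\<close> with nonempty \<open>J\<close> a nonconstant polynomial.
\<close>

lemma eventually_generic:
  fixes a :: "nat \<Rightarrow> complex"
  assumes fin: "finite I"
  shows "eventually (\<lambda>t. generic (\<lambda>i. a i + t * of_nat (Suc i)) I) (at z)"
proof -
  define b where "b = (\<lambda>t i. a i + t * of_nat (Suc i))"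
  have Suc_neq_0: "of_nat (Suc i) \<noteq> (0::complex)" for i by (rule of_nat_neq_0)
  have const: "eventually (\<lambda>t. b t i \<noteq> c) (at z)" for i c
  proof -
    have "[:a i - c, of_nat (Suc i):] \<noteq> 0" using Suc_neq_0 by simp
    from eventually_poly_neq_0[OF this] show ?thesis
      by (rule eventually_mono) (auto simp: b_def algebra_simps)
  qed
  have "eventually (\<lambda>t. b t i \<noteq> b t j) (at z)" if "i \<noteq> j" for i j
  proof -
    have "[:a i - a j, of_nat (Suc i) - of_nat (Suc j):] \<noteq> 0" using that by simp
    from eventually_poly_neq_0[OF this] show ?thesis
      by (rule eventually_mono) (auto simp: b_def algebra_simps)
  qed
  then have "eventually (\<lambda>t. i \<noteq> j \<longrightarrow> b t i \<noteq> b t j) (at z)" for i j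
    by (cases "i = j") simp_all
  then have inj: "eventually (\<lambda>t. \<forall>i\<in>I. \<forall>j\<in>I. i \<noteq> j \<longrightarrow> b t i \<noteq> b t j) (at z)"
    using fin by (intro eventually_ball_finite ballI)
  have "eventually (\<lambda>t. prod (b t) J \<noteq> 1) (at z)" if J: "J \<in> Pow I - {{}}" for J
  proof -
    let ?p = "\<Prod>j\<in>J. [:a j, of_nat (Suc j):]"
    have "finite J" "J \<noteq> {}" using J fin finite_subset by auto
    have "degree ?p = (\<Sum>j\<in>J. degree [:a j, of_nat (Suc j):])"
      using Suc_neq_0 by (intro degree_prod_eq_sum_degree) simp
    also have "\<dots> = card J" using Suc_neq_0 by simp
    finally have "degree ?p \<noteq> degree (1 :: complex poly)"
      using \<open>finite J\<close> \<open>J \<noteq> {}\<close> by simp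
    then have "?p - 1 \<noteq> 0" by auto
    from eventually_poly_neq_0[OF this] show ?thesis
      by (rule eventually_mono) (simp add: b_def poly_prod)
  qed
  then have prods: "eventually (\<lambda>t. \<forall>J\<in>Pow I - {{}}. prod (b t) J \<noteq> 1) (at z)"
    using fin by (intro eventually_ball_finite ballI) simp_all
  have special: "eventually (\<lambda>t. \<forall>i\<in>I. b t i \<noteq> 0 \<and> b t i \<noteq> -1) (at z)"
    using fin const by (intro eventually_ball_finite ballI eventually_conj)
  have "eventually (\<lambda>t. generic (b t) I) (at z)"
    using inj prods special
  proof eventually_elim
    case (elim t)
    have "inj_on (b t) I" using elim(1) unfolding inj_on_def by blast
    moreover have "0 \<notin> b t ` I" "-1 \<notin> b t ` I" using elim(3) by fastforce+
    moreover have "prod (b t) J \<noteq> 1" if "J \<subseteq> I" "J \<noteq> {}" for J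
      using elim(2) that by blast
    ultimately show ?case using fin by (simp add: generic_def)
  qed
  then show ?thesis by (simp only: b_def)
qed

lemma tendsto_det_rows:
  fixes f :: "nat \<Rightarrow> nat \<Rightarrow> complex"
  assumes "\<And>i s. ((\<lambda>t. g t i s) \<longlongrightarrow> f i s) F"
  shows "((\<lambda>t. det_rows (g t) I) \<longlongrightarrow> det_rows f I) F"
proof -
  let ?l = "sorted_list_of_set I"
  have expand: "det_rows h I = (\<Sum>p | p permutes {0..<card I}.
      signof p * (\<Prod>r = 0..<card I. h (?l ! r) (p r)))" for h :: "nat \<Rightarrow> nat \<Rightarrow> complex"
    unfolding det_rows_def
    by (subst det_def'[of _ "card I"]) (auto intro!: sum.cong prod.cong)
  show ?thesis unfolding expand by (intro tendsto_intros assms)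
qed

lemma tendsto_gam:
  assumes lim: "\<And>i. ((\<lambda>t. b t i) \<longlongrightarrow> a i) F"
    and neq: "\<And>i j. i \<in> J \<Longrightarrow> j \<in> J \<Longrightarrow> i \<noteq> j \<Longrightarrow> a i * a j \<noteq> 1" and fin: "finite J"
  shows "((\<lambda>t. gam (b t) J) \<longlongrightarrow> gam a J) F"
proof -
  let ?P = "{(i, j). i \<in> J \<and> j \<in> J \<and> i < j}"
  have "finite ?P" using fin by (auto intro: finite_subset[of _ "J \<times> J"])
  then have nz: "(\<Prod>(i, j)\<in>?P. a i * a j - 1) \<noteq> 0" using neq by auto
  have "((\<lambda>t. \<Prod>(i, j)\<in>?P. b t i * b t j - 1) \<longlongrightarrow> (\<Prod>(i, j)\<in>?P. a i * a j - 1)) F"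
    unfolding case_prod_beta by (intro tendsto_intros lim)
  moreover have "((\<lambda>t. vandermonde_det (b t) J) \<longlongrightarrow> vandermonde_det a J) F"
    unfolding vandermonde_det_eq_det_rows by (intro tendsto_det_rows tendsto_intros lim)
  ultimately show ?thesis
    unfolding gam_def using nz by (intro tendsto_mult tendsto_divide tendsto_const)
qed

lemma det_sum_eq_exponential_sum:
  assumes fin: "finite I" and neq1: "\<And>k. k \<in> I \<Longrightarrow> a k \<noteq> 1"
    and neq: "\<And>i j. i \<in> I \<Longrightarrow> j \<in> I \<Longrightarrow> i \<noteq> j \<Longrightarrow> a i * a j \<noteq> 1"
  shows "det_sum a I N = exponential_sum a I N"
proof -
  define b where "b = (\<lambda>t i. a i + t * of_nat (Suc i))"
  have lim: "((\<lambda>t. b t i) \<longlongrightarrow> a i) (at 0)" for i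
  proof -
    have "((\<lambda>t. b t i) \<longlongrightarrow> a i + 0 * of_nat (Suc i)) (at 0)"
      unfolding b_def by (intro tendsto_intros)
    then show ?thesis by simp
  qed
  have gam: "((\<lambda>t. gam (b t) J) \<longlongrightarrow> gam a J) (at 0)" if "J \<subseteq> I" for J
    using that neq fin finite_subset by (intro tendsto_gam lim) blast+
  have L: "((\<lambda>t. det_sum (b t) I N) \<longlongrightarrow> det_sum a I N) (at 0)"
    unfolding det_sum_def by (intro tendsto_sum tendsto_det_rows tendsto_intros lim)
  have "((\<lambda>t. exponential_sum (b t) I N) \<longlongrightarrow> exponential_sum a I N) (at 0)"
    unfolding exponential_sum_def subset_coeff_def
    using neq1 by (intro tendsto_intros lim gam) auto
  moreover have "eventually (\<lambda>t. exponential_sum (b t) I N = det_sum (b t) I N) (at 0)"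
    using eventually_generic[OF fin, of a 0] unfolding b_def
    by (rule eventually_mono) (simp add: det_sum_eq_exponential_sum_generic)
  ultimately have "((\<lambda>t. det_sum (b t) I N) \<longlongrightarrow> exponential_sum a I N) (at 0)"
    by (rule Lim_transform_eventually)
  with L show ?thesis by (intro tendsto_unique[of "at 0"]) simp_all
qed

theorem theorem1:
  fixes n N :: nat and a :: "nat \<Rightarrow> complex"
  assumes "n \<ge> 1" and "N \<ge> 1"
    and "\<And>k. k \<in> {1..n} \<Longrightarrow> a k \<noteq> 1"
    and "\<And>i j. i \<in> {1..n} \<Longrightarrow> j \<in> {1..n} \<Longrightarrow> i \<noteq> j \<Longrightarrow> a i * a j \<noteq> 1"
  shows "(\<Sum>x \<in> increasing_tuples n N. det (mat n n (\<lambda>(i, j). a (i + 1) ^ x (j + 1)))) =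
    (\<Prod>k = 1..n. a k / (a k - 1)) *
    (\<Sum>J \<in> Pow {1..n}. (-1) ^ nu ({1..n} - J) * gam a J * gam a ({1..n} - J) * (\<Prod>j \<in> J. a j ^ N))"
proof -
  have sorted: "sorted_list_of_set {1..n} = [1..<Suc n]"
    by (metis atLeastLessThanSuc_atLeastAtMost sorted_list_of_set_range)
  have "(\<Sum>x \<in> increasing_tuples n N. det (mat n n (\<lambda>(i, j). a (i + 1) ^ x (j + 1)))) =
      det_sum a {1..n} N"
  proof -
    have "mat n n (\<lambda>(i, j). a (i + 1) ^ x (j + 1)) =
        mat n n (\<lambda>(r, s). a (sorted_list_of_set {1..n} ! r) ^ x (s + 1))" for x :: "nat \<Rightarrow> nat"
      unfolding sorted by (intro cong_mat) (simp_all del: upt_Suc)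
    then show ?thesis by (simp only: det_sum_def det_rows_def card_atLeastAtMost diff_Suc_1)
  qed
  also have "\<dots> = exponential_sum a {1..n} N"
    using assms(3,4) by (intro det_sum_eq_exponential_sum) simp_all
  also have "\<dots> = (\<Prod>k = 1..n. a k / (a k - 1)) *
    (\<Sum>J \<in> Pow {1..n}. (-1) ^ nu ({1..n} - J) * gam a J * gam a ({1..n} - J) * (\<Prod>j \<in> J. a j ^ N))"
  proof -
    have "rank_sign {1..n} K = (-1) ^ nu K" if "K \<subseteq> {1..n}" for K
    proof -
      have "card {l \<in> {1..n}. l \<le> k} = k" if "k \<in> K" for k
      proof -
        have "{l \<in> {1..n}. l \<le> k} = {1..k}" using that \<open>K \<subseteq> {1..n}\<close> by auto
        then show ?thesis by simp
      qed
      then show ?thesis by (simp add: rank_sign_def nu_def)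
    qed
    then show ?thesis by (simp add: exponential_sum_def subset_coeff_def)
  qed
  finally show ?thesis .
qed

end
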